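(* Let $n\ge 4$, fix an orientation of $\mathbb{RP}^1$, and let $X=(x_1,\dots,x_n)$ and $Y=(y_1,\dots,y_n)$ be two $n$-tuples of pairwise distinct points of $\mathbb{RP}^1$ such that the cyclic order of each of the two $n$-tuples is the one induced by the orientation. Then there exist at least four extremal triples of consecutive indices $(i,i+1,i+2)$, $i\in\mathbb{Z}/n$.
   Context: Indices are understood cyclically modulo $n$. The cross-ratio of an ordered quadruple of points of $\mathbb{RP}^1$ is the projectively invariant number which, after choosing an affine parameter in which the points are given by real numbers $a<b<c<d$, equals $$[a,b,c,d]=\frac{(c-a)(d-b)}{(b-a)(d-c)}.$$ For each $j\in\mathbb{Z}/n$ put $$D_j=[y_j,y_{j+1},y_{j+2},y_{j+3}]-[x_j,x_{j+1},x_{j+2},x_{j+3}].$$ A triple of consecutive indices $(i,i+1,i+2)$ is called extremal if $D_j$ changes sign as $j$ changes from $i-1$ to $i$; this does not exclude the case when either of the differences vanishes. That is, the triple is extremal if and only if $D_{i-1}D_i\le 0$. *)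

theory Defs
  imports "HOL-Analysis.Analysis"
begin

typedef rp1 = "{L :: (real^2) set. subspace L \<and> dim L = 1}"
  morphisms line_of Abs_rp1
proof -
  have "span {axis 1 1 :: real^2} \<in> {L. subspace L \<and> dim L = 1}"
    by (simp add: dim_span dim_singleton)
  then show ?thesis by blast
qed

definition hom_coord :: "rp1 \<Rightarrow> real^2" where
  "hom_coord p = (SOME v. v \<in> line_of p \<and> v \<noteq> 0)"

text \<open>An affine parameter on the projective line is the quotient of the two components of an
  invertible linear map; it is encoded by the matrix of that map, and it takes the value infinity
  at the single point where the denominator vanishes.\<close>

definition affine_parameter :: "real^2^2 \<Rightarrow> bool" where
  "affine_parameter A \<longleftrightarrow> invertible A"

definition finite_at :: "real^2^2 \<Rightarrow> rp1 \<Rightarrow> bool" where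
  "finite_at A p \<longleftrightarrow> (A *v hom_coord p) $ 2 \<noteq> 0"

definition param :: "real^2^2 \<Rightarrow> rp1 \<Rightarrow> real" where
  "param A p = (A *v hom_coord p) $ 1 / (A *v hom_coord p) $ 2"

lemma hom_coord: "hom_coord p \<in> line_of p" "hom_coord p \<noteq> 0"
proof -
  have L: "dim (line_of p) = 1"
    using line_of[of p] by simp
  have "\<exists>v. v \<in> line_of p \<and> v \<noteq> 0"
  proof (rule ccontr)
    assume "\<not> ?thesis"
    then have "line_of p \<subseteq> {0}" by blast
    then have "dim (line_of p) = 0" by simp
    with L show False by simp
  qed
  then have "hom_coord p \<in> line_of p \<and> hom_coord p \<noteq> 0"
    unfolding hom_coord_def by (rule someI_ex)
  then show "hom_coord p \<in> line_of p" "hom_coord p \<noteq> 0" by auto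
qed

lemma line_of_eq_span:
  assumes "v \<in> line_of p" "v \<noteq> 0"
  shows "line_of p = span {v}"
proof -
  have L: "subspace (line_of p)" "dim (line_of p) = 1"
    using line_of[of p] by auto
  have "span {v} \<subseteq> line_of p"
    using assms(1) L(1) by (simp add: span_minimal)
  then have "span {v} = line_of p"
    using L assms(2) by (intro subspace_dim_equal) (auto simp: dim_span dim_singleton)
  then show ?thesis by simp
qed

text \<open>The choice of homogeneous coordinates is immaterial.\<close>

lemma
  assumes "v \<in> line_of p" "v \<noteq> 0"
  shows finite_at_iff: "finite_at A p \<longleftrightarrow> (A *v v) $ 2 \<noteq> 0"
    and param_eq: "param A p = (A *v v) $ 1 / (A *v v) $ 2"
proof -
  have "hom_coord p \<in> span {v}"
    using hom_coord(1)[of p] line_of_eq_span[OF assms] by simp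
  then obtain c where c: "hom_coord p = c *\<^sub>R v"
    by (auto simp: span_singleton)
  with hom_coord(2)[of p] have "c \<noteq> 0" by auto
  then show "finite_at A p \<longleftrightarrow> (A *v v) $ 2 \<noteq> 0"
    and "param A p = (A *v v) $ 1 / (A *v v) $ 2"
    by (simp_all add: finite_at_def param_def c matrix_vector_mult_scaleR)
qed

text \<open>The formula gives the same value in every affine parameter that is finite at the four
  points, whatever their order (see \<open>cross_ratio_eq\<close> below); in particular this
  applies to the parameters in which their values are increasing.\<close>

definition cross_ratio :: "rp1 \<Rightarrow> rp1 \<Rightarrow> rp1 \<Rightarrow> rp1 \<Rightarrow> real" where
  "cross_ratio a b c d = (THE r. \<exists>A. affine_parameter A \<and>
     finite_at A a \<and> finite_at A b \<and> finite_at A c \<and> finite_at A d \<and>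
     r = ((param A c - param A a) * (param A d - param A b)) /
         ((param A b - param A a) * (param A d - param A c)))"

lemma param_diff:
  assumes "finite_at A p" "finite_at A q"
  shows "param A p - param A q =
    det A * (hom_coord p $ 1 * hom_coord q $ 2 - hom_coord q $ 1 * hom_coord p $ 2) /
    ((A *v hom_coord p) $ 2 * (A *v hom_coord q) $ 2)"
proof -
  have "param A p - param A q =
    ((A *v hom_coord p) $ 1 * (A *v hom_coord q) $ 2 - (A *v hom_coord q) $ 1 * (A *v hom_coord p) $ 2) /
    ((A *v hom_coord p) $ 2 * (A *v hom_coord q) $ 2)"
    using assms unfolding finite_at_def param_def by (simp add: diff_frac_eq)
  also have "(A *v hom_coord p) $ 1 * (A *v hom_coord q) $ 2
      - (A *v hom_coord q) $ 1 * (A *v hom_coord p) $ 2 =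
    det A * (hom_coord p $ 1 * hom_coord q $ 2 - hom_coord q $ 1 * hom_coord p $ 2)"
    by (simp add: det_2 matrix_vector_mult_def sum_2 algebra_simps)
  finally show ?thesis .
qed

lemma cross_ratio_eq:
  assumes "affine_parameter A" "finite_at A a" "finite_at A b" "finite_at A c" "finite_at A d"
  shows "cross_ratio a b c d =
    ((param A c - param A a) * (param A d - param A b)) /
    ((param A b - param A a) * (param A d - param A c))"
proof -
  define e where "e p q = hom_coord p $ 1 * hom_coord q $ 2 - hom_coord q $ 1 * hom_coord p $ 2"
    for p q
  have *: "((param B c - param B a) * (param B d - param B b)) /
      ((param B b - param B a) * (param B d - param B c)) = (e c a * e d b) / (e b a * e d c)"
    if B: "affine_parameter B" "finite_at B a" "finite_at B b" "finite_at B c" "finite_at B d" for B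
  proof -
    have "det B \<noteq> 0"
      using B(1) by (simp add: affine_parameter_def invertible_det_nz)
    define w where "w p = (B *v hom_coord p) $ 2" for p
    have w: "w a \<noteq> 0" "w b \<noteq> 0" "w c \<noteq> 0" "w d \<noteq> 0"
      using B(2-5) by (simp_all add: finite_at_def w_def)
    have diff: "param B p - param B q = det B * e p q / (w p * w q)"
      if "finite_at B p" "finite_at B q" for p q
      using param_diff[OF that] by (simp add: e_def w_def)
    define k where "k = det B * det B / (w a * w b * w c * w d)"
    have "k \<noteq> 0"
      using \<open>det B \<noteq> 0\<close> w by (simp add: k_def)
    have "(param B c - param B a) * (param B d - param B b) = k * (e c a * e d b)"
      "(param B b - param B a) * (param B d - param B c) = k * (e b a * e d c)"
      using B(2-5) by (simp_all add: diff k_def ac_simps)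
    then show ?thesis
      using \<open>k \<noteq> 0\<close> by simp
  qed
  show ?thesis
    unfolding cross_ratio_def
    by (rule the_equality) (use assms * in blast, use assms * in metis)
qed

text \<open>An orientation is represented by the set of affine parameters that increase along it. The
  transition between the parameters \<open>A\<close> and \<open>B\<close> is the fractional linear map with matrix
  \<open>B ** matrix_inv A\<close>, which is increasing exactly if the determinants of \<open>A\<close> and \<open>B\<close> have the
  same sign.\<close>

definition orientations :: "(real^2^2) set set" where
  "orientations = {{A. det A > 0}, {A. det A < 0}}"

text \<open>Travelling in the positive direction from \<open>p\<close>, one meets \<open>q\<close> before \<open>r\<close>: cutting the
  projective line at a point between \<open>r\<close> and \<open>p\<close> makes the three points increasing.\<close>

definition cyclically_ordered :: "(real^2^2) set \<Rightarrow> rp1 \<Rightarrow> rp1 \<Rightarrow> rp1 \<Rightarrow> bool" where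
  "cyclically_ordered Or p q r \<longleftrightarrow> (\<exists>A\<in>Or. finite_at A p \<and> finite_at A q \<and> finite_at A r \<and>
     param A p < param A q \<and> param A q < param A r)"

text \<open>Cyclically indexed \<open>n\<close>-tuples are represented by \<open>n\<close>-periodic functions on the integers.\<close>

definition cyclic_tuple :: "nat \<Rightarrow> (int \<Rightarrow> rp1) \<Rightarrow> bool" where
  "cyclic_tuple n x \<longleftrightarrow> (\<forall>i. x (i + int n) = x i)"

definition in_cyclic_order :: "(real^2^2) set \<Rightarrow> nat \<Rightarrow> (int \<Rightarrow> rp1) \<Rightarrow> bool" where
  "in_cyclic_order Or n x \<longleftrightarrow> (\<forall>i j k. 1 \<le> i \<and> i < j \<and> j < k \<and> k \<le> int n \<longrightarrow>
     cyclically_ordered Or (x i) (x j) (x k))"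

definition cr_diff :: "(int \<Rightarrow> rp1) \<Rightarrow> (int \<Rightarrow> rp1) \<Rightarrow> int \<Rightarrow> real" where
  "cr_diff x y j = cross_ratio (y j) (y (j + 1)) (y (j + 2)) (y (j + 3))
                 - cross_ratio (x j) (x (j + 1)) (x (j + 2)) (x (j + 3))"

text \<open>Extremality of the triple \<open>(i, i + 1, i + 2)\<close>.\<close>

definition extremal :: "(int \<Rightarrow> rp1) \<Rightarrow> (int \<Rightarrow> rp1) \<Rightarrow> int \<Rightarrow> bool" where
  "extremal x y i \<longleftrightarrow> cr_diff x y (i - 1) * cr_diff x y i \<le> 0"

end

(* Discrete version of the Wronskian proof of Ghys' theorem on the zeros of the Schwarzian.
   Lift the points to vectors v_i, w_i of the plane with v_(i+n) = -v_i, w_(i+n) = -w_i and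
   [v_i, v_j] > 0, [w_i, w_j] > 0 for i < j < i + n. Let M_j be the linear map of determinant one
   that takes v_j, v_(j+1), v_(j+2) to positive multiples of w_j, w_(j+1), w_(j+2). The maps M_j
   and M_(j+1) are both diagonal on v_(j+1), v_(j+2), and there M_(j+1) stretches one of the two
   directions more, and the other one less, than M_j, according to the sign of D_j. Hence, for
   a < b < a + n, the increments of the n-periodic function j |-> [M_j v_a, w_b] have the sign of
   -D_j for a - 1 <= j <= b - 2 and the sign of D_j for b - 1 <= j <= a + n - 2. Their sum over a
   period is zero, so D cannot be nonpositive on one of these arcs and nonnegative on the other
   unless it vanishes; the case a = b excludes a constant sign. Three cyclic arcs of weakly
   constant sign always reduce to one of these two cases. *)

theory Submission
  imports Defs
begin

section \<open>Brackets of an antiperiodic lift\<close>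

text \<open>The pairwise determinants \<open>V i j = [v\<^sub>i, v\<^sub>j]\<close> of a lift with
  \<open>v\<^bsub>i+n\<^esub> = - v\<^sub>i\<close>; the vectors themselves are never needed.\<close>

locale cyclic_bracket =
  fixes n :: nat and V :: "int \<Rightarrow> int \<Rightarrow> real"
  assumes antisym: "V j i = - V i j"
    and plucker: "V i j * V k l - V i k * V j l + V i l * V j k = 0"
    and shift: "V (i + int n) j = - V i j"
    and pos: "i < j \<Longrightarrow> j < i + int n \<Longrightarrow> V i j > 0"
begin

lemma self: "V i i = 0"
  using antisym[of i i] by simp

lemma shift_right: "V i (j + int n) = - V i j"
  by (metis antisym shift)

lemma nonneg: "i \<le> j \<Longrightarrow> j \<le> i + int n \<Longrightarrow> V i j \<ge> 0"
  using pos[of i j] by (cases "j = i \<or> j = i + int n") (auto simp: self shift_right)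

lemma nonpos: "i \<le> j \<Longrightarrow> j \<le> i + int n \<Longrightarrow> V j i \<le> 0"
  using nonneg[of i j] antisym[of j i] by simp

lemma neg: "i < j \<Longrightarrow> j < i + int n \<Longrightarrow> V j i < 0"
  using pos[of i j] antisym[of j i] by simp

text \<open>This is the cross-ratio of four consecutive points: every index occurs once in the
  numerator and once in the denominator, so rescaling the lifted vectors has no effect.\<close>

definition ratio :: "int \<Rightarrow> real" where
  "ratio j = (V j (j + 2) * V (j + 1) (j + 3)) / (V j (j + 1) * V (j + 2) (j + 3))"

end

section \<open>Signs and periodic sequences\<close>

lemma sgn_diff_sqrt: "sgn (sqrt a - sqrt b) = sgn (a - b)"
  by (simp add: sgn_if)

text \<open>Turns the sign of an increment of \<open>F\<close> into monotonicity up to the factor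
  \<open>s\<close>.\<close>

lemma mult_nonneg_if_sgn:
  fixes s x y :: real
  assumes "sgn x \<in> {0, sgn y}" "s * y \<ge> 0"
  shows "s * x \<ge> 0"
proof (cases "x = 0")
  case False
  then have "sgn x = sgn y" using assms(1) by (auto simp: sgn_0_0)
  then have "sgn (s * x) = sgn (s * y)" by (simp add: sgn_mult)
  moreover have "sgn (s * y) \<ge> 0" using assms(2) by simp
  ultimately show ?thesis using zero_le_sgn_iff by metis
qed simp

text \<open>The increments over one period telescope to zero, and nonnegative numbers with sum zero
  all vanish.\<close>

lemma periodic_monotone_eq:
  fixes F :: "int \<Rightarrow> real"
  assumes per: "F (m + int n) = F m"
    and mono: "\<And>j. m \<le> j \<Longrightarrow> j < m + int n \<Longrightarrow> F j \<le> F (j + 1)"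
    and j: "m \<le> j" "j < m + int n"
  shows "F (j + 1) = F j"
proof -
  let ?f = "\<lambda>k. F (m + int (Suc k)) - F (m + int k)"
  have "(\<Sum>k<n. ?f k) = 0"
    using sum_lessThan_telescope[of "\<lambda>k. F (m + int k)" n] per by simp
  moreover have "0 \<le> ?f k" if "k < n" for k
    using mono[of "m + int k"] that by (simp add: ac_simps)
  then have "\<forall>k\<in>{..<n}. 0 \<le> ?f k" by blast
  ultimately have "\<forall>k\<in>{..<n}. ?f k = 0"
    by (subst (asm) sum_nonneg_eq_0_iff) auto
  moreover have "nat (j - m) \<in> {..<n}" using j by auto
  ultimately have "?f (nat (j - m)) = 0" by blast
  then show ?thesis using j by (simp add: algebra_simps)
qed

lemma periodic_shift:
  fixes f :: "int \<Rightarrow> 'a"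
  assumes "\<And>i. f (i + p) = f i"
  shows "f (i + p * k) = f i"
proof (induction k rule: int_induct[where k = 0])
  case (step1 k)
  then show ?case using assms[of "i + p * k"] by (simp add: algebra_simps)
next
  case (step2 k)
  then show ?case using assms[of "i + p * (k - 1)"] by (simp add: algebra_simps)
qed simp

lemma periodic_window:
  fixes f :: "int \<Rightarrow> 'a"
  assumes "\<And>i. f (i + int n) = f i" "n > 0"
  obtains j where "m \<le> j" "j < m + int n" "f j = f i"
proof
  let ?j = "m + (i - m) mod int n"
  show "m \<le> ?j" "?j < m + int n" using assms(2) by simp_all
  have "i = ?j + int n * ((i - m) div int n)"
    using div_mult_mod_eq[of "i - m" "int n"] by (simp add: algebra_simps)
  then show "f ?j = f i" using periodic_shift[of f "int n" ?j] assms(1) by metis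
qed

text \<open>Equal products make \<open>q' - q\<close> a negative multiple of \<open>p' - p\<close>,
  so the weighted difference is \<open>(p' - p) * (P + q / p' * Q)\<close>. In the application
  \<open>p, q\<close> and \<open>p', q'\<close> are the stretch factors of two maps along the same
  two directions.\<close>

lemma sgn_weighted_diff:
  fixes p q p' q' P Q d :: real
  assumes "p > 0" "q > 0" "p' > 0" "q' > 0" "p * q = p' * q'" "sgn (p' - p) = - sgn d"
    and "P \<ge> 0" "Q \<ge> 0"
  shows "sgn ((p' - p) * P - (q' - q) * Q) \<in> {0, - sgn d}"
    and "P > 0 \<or> Q > 0 \<Longrightarrow> sgn ((p' - p) * P - (q' - q) * Q) = - sgn d"
proof -
  have q: "q' - q = - ((p' - p) * (q / p'))"
    using assms by (simp add: field_simps)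
  let ?K = "P + q / p' * Q"
  have e: "(p' - p) * P - (q' - q) * Q = (p' - p) * ?K"
    unfolding q by (simp add: algebra_simps)
  have K: "?K \<ge> 0" "P > 0 \<or> Q > 0 \<Longrightarrow> ?K > 0"
    using assms by (auto intro: add_pos_nonneg add_nonneg_pos)
  show "P > 0 \<or> Q > 0 \<Longrightarrow> sgn ((p' - p) * P - (q' - q) * Q) = - sgn d"
    using K(2) assms(6) unfolding e by (simp add: sgn_mult)
  show "sgn ((p' - p) * P - (q' - q) * Q) \<in> {0, - sgn d}"
    using K(1) assms(6) unfolding e by (cases "?K = 0") (auto simp add: sgn_mult)
qed

section \<open>Comparison maps between two lifts\<close>

locale cyclic_bracket_pair = X: cyclic_bracket n V + Y: cyclic_bracket n W
  for n V W +
  assumes n4: "n \<ge> 4"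
begin

text \<open>For a linear map of determinant one that stretches the \<open>i\<close>-th and
  \<open>j\<close>-th vectors of the first lift onto multiples of those of the second,
  \<open>r i j\<close> is the product of the two stretch factors.\<close>

definition r :: "int \<Rightarrow> int \<Rightarrow> real" where
  "r i j = V i j / W i j"

text \<open>If \<open>M v\<^sub>i\<close>, \<open>M v\<^sub>j\<close>, \<open>M v\<^sub>k\<close> are positive multiples of \<open>w\<^sub>i\<close>,
  \<open>w\<^sub>j\<close>, \<open>w\<^sub>k\<close> and \<open>det M = 1\<close>, then \<open>M v\<^sub>i = c i j k w\<^sub>i\<close>.\<close>

definition c :: "int \<Rightarrow> int \<Rightarrow> int \<Rightarrow> real" where
  "c i j k = sqrt (r i j * r i k / r j k)"

lemma r_commute: "r i j = r j i"
  using X.antisym[of i j] Y.antisym[of i j] by (simp add: r_def)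

lemma r_pos: "i < j \<Longrightarrow> j < i + int n \<Longrightarrow> r i j > 0"
  using X.pos[of i j] Y.pos[of i j] by (simp add: r_def)

lemma c_commute: "c i j k = c i k j"
  by (simp add: c_def mult.commute r_commute[of j k])

lemma r_shift: "r (i + int n) (j + int n) = r i j"
  by (simp add: r_def X.shift Y.shift X.shift_right Y.shift_right)

lemma c_shift: "c (i + int n) (j + int n) (k + int n) = c i j k"
  by (simp add: c_def r_shift)

text \<open>Under the root \<open>r i k\<close> and \<open>r j k\<close> cancel and the square of
  \<open>r i j\<close> remains.\<close>

lemma c_mult: "r i j > 0 \<Longrightarrow> r i k > 0 \<Longrightarrow> r j k > 0 \<Longrightarrow> c i j k * c j i k = r i j"
  unfolding c_def by (simp add: r_commute[of j i] flip: real_sqrt_mult)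

lemma c_pos: "r i j > 0 \<Longrightarrow> r i k > 0 \<Longrightarrow> r j k > 0 \<Longrightarrow> c i j k > 0"
  by (simp add: c_def)

text \<open>\<open>F a b j = [M\<^sub>j v\<^sub>a, w\<^sub>b]\<close>, with \<open>v\<^sub>a\<close> expanded in the basis
  \<open>v\<^sub>j, v\<^bsub>j+1\<^esub>\<close>; \<open>F_alt\<close> is the expansion in \<open>v\<^bsub>j+1\<^esub>, v\<^bsub>j+2\<^esub>\<close>.\<close>

definition F :: "int \<Rightarrow> int \<Rightarrow> int \<Rightarrow> real" where
  "F a b j = (V a (j + 1) * c j (j + 1) (j + 2) * W j b
     + V j a * c (j + 1) j (j + 2) * W (j + 1) b) / V j (j + 1)"

lemma F_shift: "F a b (j + int n) = F a b j"
proof -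
  have e: "j + int n + 1 = j + 1 + int n" "j + int n + 2 = j + 2 + int n" by simp_all
  show ?thesis
    unfolding F_def e c_shift X.shift Y.shift X.shift_right by simp
qed

lemma F_alt:
  "F a b j = (V a (j + 2) * c (j + 1) j (j + 2) * W (j + 1) b
     + V (j + 1) a * c (j + 2) j (j + 1) * W (j + 2) b) / V (j + 1) (j + 2)"
proof -
  have r: "r j (j + 1) > 0" "r j (j + 2) > 0" "r (j + 1) (j + 2) > 0"
    using n4 by (auto intro!: r_pos)
  have r': "r (j + 1) j > 0" "r (j + 2) j > 0" "r (j + 2) (j + 1) > 0"
    using r r_commute by metis+
  define c0 c1 c2 where "c0 = c j (j + 1) (j + 2)" and "c1 = c (j + 1) j (j + 2)"
    and "c2 = c (j + 2) j (j + 1)"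
  have c: "c0 > 0" "c1 > 0" "c2 > 0"
    unfolding c0_def c1_def c2_def using r r' by (auto intro!: c_pos)
  define V01 V02 V12 W01 W02 W12 where "V01 = V j (j + 1)" and "V02 = V j (j + 2)"
    and "V12 = V (j + 1) (j + 2)" and "W01 = W j (j + 1)" and "W02 = W j (j + 2)"
    and "W12 = W (j + 1) (j + 2)"
  have W: "W01 > 0" "W02 > 0" "W12 > 0"
    unfolding W01_def W02_def W12_def using n4 by (auto intro!: Y.pos)
  \<comment> \<open>Expressing the brackets of \<open>V\<close> by those of \<open>W\<close> and the
    stretch factors leaves a polynomial identity without roots.\<close>
  have "c0 * c1 = r j (j + 1)"
    unfolding c0_def c1_def using r by (intro c_mult)
  then have V01: "V01 = c0 * c1 * W01"
    using W by (simp add: r_def V01_def W01_def)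
  have "c0 * c2 = r j (j + 2)"
    unfolding c0_def c2_def using r r' c_mult[of j "j + 2" "j + 1"] by (simp add: c_commute)
  then have V02: "V02 = c0 * c2 * W02"
    using W by (simp add: r_def V02_def W02_def)
  have "c1 * c2 = r (j + 1) (j + 2)"
    unfolding c1_def c2_def using r r' c_mult[of "j + 1" "j + 2" j] by (simp add: c_commute)
  then have V12: "V12 = c1 * c2 * W12"
    using W by (simp add: r_def V12_def W12_def)
  define s0 s1 s2 where "s0 = V j a" and "s1 = V (j + 1) a" and "s2 = V (j + 2) a"
  define t0 t1 t2 where "t0 = W j b" and "t1 = W (j + 1) b" and "t2 = W (j + 2) b"
  have PV: "V01 * s2 - V02 * s1 + s0 * V12 = 0"
    using X.plucker[of j "j + 1" "j + 2" a]
    by (simp add: V01_def V02_def V12_def s0_def s1_def s2_def)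
  have PW: "W01 * t2 - W02 * t1 + t0 * W12 = 0"
    using Y.plucker[of j "j + 1" "j + 2" b]
    by (simp add: W01_def W02_def W12_def t0_def t1_def t2_def)
  have PV': "c1 * W01 * c0 * s2 + c1 * c2 * W12 * s0 = c0 * c2 * W02 * s1"
    using PV unfolding V01 V02 V12 by (simp add: algebra_simps)
  have sw: "V a (j + 1) = - s1" "V a (j + 2) = - s2"
    unfolding s1_def s2_def by (rule X.antisym)+
  \<comment> \<open>The equality of the two expansions, cross-multiplied. The Plucker relation
    \<open>PW\<close> eliminates \<open>t0\<close> and \<open>t2\<close>; then \<open>PV'\<close>
    cancels what multiplies \<open>t1\<close>.\<close>
  have "(- s1 * c0 * t0 + s0 * c1 * t1) * V12 - (- s2 * c1 * t1 + s1 * c2 * t2) * V01 = 0"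
  proof -
    have "(- s1 * c0 * t0 + s0 * c1 * t1) * V12 - (- s2 * c1 * t1 + s1 * c2 * t2) * V01
       = c1 * (c1 * W01 * c0 * s2 + c1 * c2 * W12 * s0 ) * t1
         - c0 * c1 * c2 * s1 * (t0 * W12 + W01 * t2)"
      unfolding V01 V12 by (simp add: algebra_simps)
    also have "t0 * W12 + W01 * t2 = W02 * t1" using PW by simp
    finally show ?thesis unfolding PV' by (simp add: algebra_simps)
  qed
  then have "(- s1 * c0 * t0 + s0 * c1 * t1) / V01 = (- s2 * c1 * t1 + s1 * c2 * t2) / V12"
    using W c by (simp add: V01 V12 frac_eq_eq)
  then show ?thesis
    unfolding F_def sw c0_def[symmetric] c1_def[symmetric] c2_def[symmetric]
      s0_def[symmetric] s1_def[symmetric] t0_def[symmetric] t1_def[symmetric] t2_def[symmetric]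
      V01_def[symmetric] V12_def[symmetric] .
qed

definition d :: "int \<Rightarrow> real" where
  "d j = Y.ratio j - X.ratio j"

text \<open>Expanding by \<open>F_alt\<close> at \<open>j\<close> and by \<open>F_def\<close> at
  \<open>j + 1\<close> uses the same basis with indices \<open>j + 1\<close>, \<open>j + 2\<close>.
  The increment is therefore a weighted difference of stretch factors, and \<open>P\<close>,
  \<open>Q\<close> are the products of coordinates that serve as weights.\<close>

lemma F_step:
  fixes a b j :: int
  defines "P \<equiv> V a (j + 2) * W (j + 1) b" and "Q \<equiv> V a (j + 1) * W (j + 2) b"
  shows "P \<ge> 0 \<Longrightarrow> Q \<ge> 0 \<Longrightarrow> P > 0 \<or> Q > 0 \<Longrightarrow> sgn (F a b (j + 1) - F a b j) = - sgn (d j)"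
    and "P \<le> 0 \<Longrightarrow> Q \<le> 0 \<Longrightarrow> sgn (F a b (j + 1) - F a b j) \<in> {0, sgn (d j)}"
    and "P \<le> 0 \<Longrightarrow> Q \<le> 0 \<Longrightarrow> P < 0 \<or> Q < 0 \<Longrightarrow> sgn (F a b (j + 1) - F a b j) = sgn (d j)"
proof -
  define p q p' q' where "p = c (j + 1) j (j + 2)" and "q = c (j + 2) j (j + 1)"
    and "p' = c (j + 1) (j + 2) (j + 3)" and "q' = c (j + 2) (j + 1) (j + 3)"
  have r: "r j (j + 1) > 0" "r j (j + 2) > 0" "r (j + 1) (j + 2) > 0"
    "r (j + 1) (j + 3) > 0" "r (j + 2) (j + 3) > 0"
    using n4 by (auto intro!: r_pos)
  have r': "r (j + 1) j > 0" "r (j + 2) j > 0" "r (j + 2) (j + 1) > 0"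
    using r r_commute by metis+
  have c: "p > 0" "q > 0" "p' > 0" "q' > 0"
    unfolding p_def q_def p'_def q'_def using r r' by (auto intro!: c_pos)
  have pq: "p * q = p' * q'"
    unfolding p_def q_def p'_def q'_def
    using r r' c_mult[of "j + 1" "j + 2" j] c_mult[of "j + 1" "j + 2" "j + 3"]
    by (simp add: c_commute)
  \<comment> \<open>Compare the squares: the quotient of \<open>p'\<close> squared by
    \<open>p\<close> squared is \<open>X.ratio j / Y.ratio j\<close>.\<close>
  have "sgn (p' - p) = - sgn (d j)"
  proof -
    define A where "A = r (j + 1) (j + 2)"
    have A: "A > 0" using r by (simp add: A_def)
    have "sgn (p' - p) = sgn (A * r (j + 1) (j + 3) / r (j + 2) (j + 3)
        - r j (j + 1) * A / r j (j + 2))"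
      unfolding p'_def p_def c_def A_def by (simp add: sgn_diff_sqrt r_commute[of "j + 1" j])
    also have "\<dots> = sgn (A * r j (j + 1) / r j (j + 2) *
        (r j (j + 2) * r (j + 1) (j + 3) / (r j (j + 1) * r (j + 2) (j + 3)) - 1))"
      using r A by (intro arg_cong[where f = sgn]) (simp add: field_simps)
    also have "\<dots> = sgn (r j (j + 2) * r (j + 1) (j + 3) / (r j (j + 1) * r (j + 2) (j + 3)) - 1)"
      using r A by (simp add: sgn_mult)
    also have "r j (j + 2) * r (j + 1) (j + 3) / (r j (j + 1) * r (j + 2) (j + 3))
        = X.ratio j / Y.ratio j"
      by (simp add: r_def X.ratio_def Y.ratio_def)
    also have "sgn (X.ratio j / Y.ratio j - 1) = - sgn (d j)"
    proof -
      have "Y.ratio j > 0"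
        using n4 unfolding Y.ratio_def by (auto intro!: divide_pos_pos mult_pos_pos Y.pos)
      then show ?thesis by (simp add: d_def sgn_if field_simps)
    qed
    finally show ?thesis .
  qed
  note w = sgn_weighted_diff[OF c pq this]
  let ?B = "V (j + 1) (j + 2)"
  have B: "?B > 0" using n4 by (intro X.pos) auto
  have "F a b (j + 1) - F a b j = ((p' - p) * P - (q' - q) * Q) / ?B"
    unfolding F_alt[of a b j] F_def[of a b "j + 1"] P_def Q_def p_def q_def p'_def q'_def
      X.antisym[of "j + 1" a]
    by (simp add: algebra_simps diff_divide_distrib add_divide_distrib)
  then have e: "sgn (F a b (j + 1) - F a b j) = sgn ((p' - p) * P - (q' - q) * Q)"
    using B by (simp add: sgn_divide)
  have e': "(p' - p) * P - (q' - q) * Q = - ((p' - p) * (- P) - (q' - q) * (- Q))" by simp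
  show "P \<ge> 0 \<Longrightarrow> Q \<ge> 0 \<Longrightarrow> P > 0 \<or> Q > 0 \<Longrightarrow> sgn (F a b (j + 1) - F a b j) = - sgn (d j)"
    unfolding e by (rule w)
  show "P \<le> 0 \<Longrightarrow> Q \<le> 0 \<Longrightarrow> sgn (F a b (j + 1) - F a b j) \<in> {0, sgn (d j)}"
    using w(1)[of "- P" "- Q"] unfolding e e' sgn_minus by auto
  show "P \<le> 0 \<Longrightarrow> Q \<le> 0 \<Longrightarrow> P < 0 \<or> Q < 0 \<Longrightarrow> sgn (F a b (j + 1) - F a b j) = sgn (d j)"
    using w(2)[of "- P" "- Q"] unfolding e e' sgn_minus by auto
qed

section \<open>Arcs of weakly constant sign\<close>

lemma d_shift: "d (j + int n) = d j"
proof -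
  have e: "j + int n + 1 = j + 1 + int n" "j + int n + 2 = j + 2 + int n"
    "j + int n + 3 = j + 3 + int n" by simp_all
  show ?thesis
    unfolding d_def X.ratio_def Y.ratio_def e X.shift Y.shift X.shift_right Y.shift_right by simp
qed

lemma d_zero_if_window:
  assumes "\<And>j. m \<le> j \<Longrightarrow> j < m + int n \<Longrightarrow> d j = 0"
  shows "d i = 0"
proof (rule periodic_window[of d n m i])
  fix j assume "m \<le> j" "j < m + int n" "d j = d i"
  then show "d i = 0" using assms[of j] by simp
qed (use n4 d_shift in auto)

text \<open>For \<open>b = a\<close> the weights are nonpositive over the whole period starting at
  \<open>a - 1\<close>, so \<open>F a a\<close> is monotone and periodic, hence constant. At
  \<open>j = a\<close> one weight is strictly negative, which forces \<open>d a = 0\<close>.\<close>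

lemma one_sign:
  assumes "\<bar>\<sigma>\<bar> = 1" and "\<And>j. \<sigma> * d j \<ge> 0"
  shows "d a = 0"
proof -
  have s: "sgn (F a a (j + 1) - F a a j) \<in> {0, sgn (d j)}"
    if "a - 1 \<le> j" "j < a - 1 + int n" for j
    by (rule F_step(2); intro mult_nonneg_nonpos X.nonneg Y.nonpos) (use that n4 in auto)
  have "\<sigma> * F a a (a + 1) = \<sigma> * F a a a"
  proof (rule periodic_monotone_eq[where n = n and m = "a - 1" and F = "\<lambda>j. \<sigma> * F a a j"])
    show "\<sigma> * F a a j \<le> \<sigma> * F a a (j + 1)" if "a - 1 \<le> j" "j < a - 1 + int n" for j
      using mult_nonneg_if_sgn[OF s[OF that] assms(2)] by (simp add: right_diff_distrib)
  qed (use n4 F_shift in auto)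
  moreover have "sgn (F a a (a + 1) - F a a a) = sgn (d a)"
  proof (rule F_step(3))
    show "V a (a + 2) * W (a + 1) a \<le> 0"
      using n4 by (intro mult_nonneg_nonpos X.nonneg Y.nonpos) auto
    have "V a (a + 1) * W (a + 2) a < 0"
      using n4 by (intro mult_pos_neg X.pos Y.neg) auto
    then show "V a (a + 1) * W (a + 2) a \<le> 0"
      "V a (a + 2) * W (a + 1) a < 0 \<or> V a (a + 1) * W (a + 2) a < 0" by auto
  qed
  ultimately show ?thesis using assms(1) by (auto simp: sgn_0_0)
qed

text \<open>The weights change sign exactly where \<open>d\<close> may do so, which makes
  \<open>F\<close> monotone up to the sign \<sigma>, hence constant. On each arc one weight is
  nonzero at every \<open>j\<close>, so every \<open>d j\<close> vanishes.\<close>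

lemma two_arcs:
  assumes \<sigma>: "\<bar>\<sigma>\<bar> = 1" and ab: "a < b" "b < a + int n"
    and le: "\<And>j. a \<le> j \<Longrightarrow> j < b \<Longrightarrow> \<sigma> * d j \<le> 0"
    and ge: "\<And>j. b \<le> j \<Longrightarrow> j < a + int n \<Longrightarrow> \<sigma> * d j \<ge> 0"
  shows "d i = 0"
proof (rule d_zero_if_window[where m = a])
  \<comment> \<open>The shift by one places the sign changes of the weights at \<open>j = a\<close>
    and \<open>j = b\<close>.\<close>
  let ?F = "F (a + 1) (b + 1)"
  have s1: "sgn (?F (j + 1) - ?F j) = - sgn (d j)" if "a \<le> j" "j < b" for j
  proof (rule F_step(1))
    have "V (a + 1) (j + 2) * W (j + 1) (b + 1) > 0"
      using that ab by (intro mult_pos_pos X.pos Y.pos) auto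
    then show "V (a + 1) (j + 2) * W (j + 1) (b + 1) \<ge> 0"
      "V (a + 1) (j + 2) * W (j + 1) (b + 1) > 0 \<or> V (a + 1) (j + 1) * W (j + 2) (b + 1) > 0"
      by auto
    show "V (a + 1) (j + 1) * W (j + 2) (b + 1) \<ge> 0"
      using that ab by (intro mult_nonneg_nonneg X.nonneg Y.nonneg) auto
  qed
  have s2: "sgn (?F (j + 1) - ?F j) = sgn (d j)" if "b \<le> j" "j < a + int n" for j
  proof (rule F_step(3))
    have "V (a + 1) (j + 1) * W (j + 2) (b + 1) < 0"
      using that ab by (intro mult_pos_neg X.pos Y.neg) auto
    then show "V (a + 1) (j + 1) * W (j + 2) (b + 1) \<le> 0"
      "V (a + 1) (j + 2) * W (j + 1) (b + 1) < 0 \<or> V (a + 1) (j + 1) * W (j + 2) (b + 1) < 0"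
      by auto
    show "V (a + 1) (j + 2) * W (j + 1) (b + 1) \<le> 0"
      using that ab by (intro mult_nonneg_nonpos X.nonneg Y.nonpos) auto
  qed
  fix j assume j: "a \<le> j" "j < a + int n"
  have "\<sigma> * ?F (j + 1) = \<sigma> * ?F j"
  proof (rule periodic_monotone_eq[where n = n and m = a and F = "\<lambda>j. \<sigma> * ?F j"])
    show "\<sigma> * ?F j \<le> \<sigma> * ?F (j + 1)" if "a \<le> j" "j < a + int n" for j
    proof (cases "j < b")
      case True
      then have "sgn (?F (j + 1) - ?F j) \<in> {0, sgn (- d j)}"
        using s1[of j] True that by (simp add: sgn_minus)
      moreover have "\<sigma> * - d j \<ge> 0" using le[of j] True that by simp
      ultimately have "\<sigma> * (?F (j + 1) - ?F j) \<ge> 0" by (rule mult_nonneg_if_sgn)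
      then show ?thesis by (simp add: right_diff_distrib)
    next
      case False
      then have "sgn (?F (j + 1) - ?F j) \<in> {0, sgn (d j)}"
        using s2[of j] that by simp
      moreover have "\<sigma> * d j \<ge> 0" using ge[of j] False that by simp
      ultimately have "\<sigma> * (?F (j + 1) - ?F j) \<ge> 0" by (rule mult_nonneg_if_sgn)
      then show ?thesis by (simp add: right_diff_distrib)
    qed
  qed (use j F_shift in auto)
  then have "?F (j + 1) - ?F j = 0" using \<sigma> by auto
  then have "sgn (d j) = 0"
    using s1[of j] s2[of j] j by (cases "j < b") auto
  then show "d j = 0" by (simp add: sgn_0_0)
qed

lemma sgn_constant:
  assumes "\<And>i. a < i \<Longrightarrow> i < b \<Longrightarrow> d (i - 1) * d i > 0" "a \<le> j" "j < b"
  shows "sgn (d j) = sgn (d a)"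
  using assms(2,3)
proof (induction j rule: int_ge_induct)
  case (step i)
  then have "d i * d (i + 1) > 0" using assms(1)[of "i + 1"] by simp
  then have "sgn (d (i + 1)) = sgn (d i)" by (auto simp: zero_less_mult_iff)
  then show ?case using step by simp
qed simp

text \<open>Otherwise all extremal indices lie in a set \<open>T\<close> of exactly three, obtained
  by padding if necessary. Its elements cut the cycle into three arcs of constant sign, and two of
  the three signs agree weakly, which reduces to \<open>one_sign\<close> or
  \<open>two_arcs\<close>.\<close>

lemma four_sign_changes: "card {i \<in> {1..int n}. d (i - 1) * d i \<le> 0} \<ge> 4"
proof (rule ccontr)
  let ?S = "{i \<in> {1..int n}. d (i - 1) * d i \<le> 0}"
  assume "\<not> ?thesis"
  then have "card ?S \<le> 3" by simp
  moreover have "3 \<le> card {1..int n}" using n4 by simp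
  ultimately obtain T where T: "?S \<subseteq> T" "T \<subseteq> {1..int n}" "card T = 3"
    using exists_subset_between[of ?S 3 "{1..int n}"] by blast
  have "\<exists>t1 t2 t3. t1 < t2 \<and> t2 < t3 \<and> T = {t1, t2, t3}"
  proof -
    obtain u v w where "T = {u, v, w}" "u \<noteq> v" "v \<noteq> w" "u \<noteq> w"
      using T(3) card_3_iff[of T] by auto
    then show ?thesis
      by (metis insert_commute linorder_neqE)
  qed
  then obtain t1 t2 t3 where t: "t1 < t2" "t2 < t3" and Teq: "T = {t1, t2, t3}" by blast
  have t1: "t1 \<ge> 1" and t3: "t3 \<le> int n" using T(2) Teq by auto
  have pos: "d (i - 1) * d i > 0" if "1 \<le> i" "i \<le> int n" "i \<notin> T" for i
    using that T(1) by force
  \<comment> \<open>An index outside \<open>T\<close> exists since \<open>n\<close> is at least 4;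
    the strict inequality there excludes that \<open>d\<close> vanishes identically.\<close>
  have nz: "\<exists>i. d i \<noteq> 0"
  proof -
    have "card T < card {1..int n}" using T(3) n4 by simp
    then have "T \<noteq> {1..int n}" by auto
    then obtain i where "i \<in> {1..int n}" "i \<notin> T" using T(2) by blast
    then have "d i \<noteq> 0" using pos[of i] by auto
    then show ?thesis ..
  qed
  have s1: "sgn (d j) = sgn (d t1)" if "t1 \<le> j" "j < t2" for j
    by (rule sgn_constant[OF _ that], rule pos) (use t t1 t3 Teq in auto)
  have s2: "sgn (d j) = sgn (d t2)" if "t2 \<le> j" "j < t3" for j
    by (rule sgn_constant[OF _ that], rule pos) (use t t1 t3 Teq in auto)
  \<comment> \<open>The third arc wraps around: indices beyond \<open>n\<close> are moved back by
    one period.\<close>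
  have s3: "sgn (d j) = sgn (d t3)" if "t3 \<le> j" "j < t1 + int n" for j
  proof (rule sgn_constant[OF _ that])
    fix i assume i: "t3 < i" "i < t1 + int n"
    show "d (i - 1) * d i > 0"
    proof (cases "i \<le> int n")
      case True
      then show ?thesis using i t t1 Teq by (intro pos) auto
    next
      case False
      then have "d (i - int n - 1) * d (i - int n) > 0"
        using i t t3 Teq by (intro pos) auto
      then show ?thesis
        using d_shift[of "i - int n - 1"] d_shift[of "i - int n"] by simp
    qed
  qed
  have s1': "sgn (d j) = sgn (d t1)" if "t1 + int n \<le> j" "j < t2 + int n" for j
    using s1[of "j - int n"] d_shift[of "j - int n"] that by simp
  have s2': "sgn (d j) = sgn (d t2)" if "t2 + int n \<le> j" "j < t3 + int n" for j
    using s2[of "j - int n"] d_shift[of "j - int n"] that by simp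
  have sg: "\<sigma> * d j \<ge> 0" if "sgn (d j) = sgn (d k)" "\<sigma> * d k \<ge> 0" for \<sigma> j k
    by (rule mult_nonneg_if_sgn[of _ "d k"]) (use that in auto)
  have sg': "\<sigma> * d j \<le> 0" if "sgn (d j) = sgn (d k)" "\<sigma> * d k \<le> 0" for \<sigma> j k
    using sg[of j k "- \<sigma>"] that by simp
  have A0: False if "\<bar>\<sigma>\<bar> = 1" "\<sigma> * d t1 \<ge> 0" "\<sigma> * d t2 \<ge> 0" "\<sigma> * d t3 \<ge> 0" for \<sigma>
  proof -
    have win: "\<sigma> * d j \<ge> 0" if "t1 \<le> j" "j < t1 + int n" for j
      using \<open>\<sigma> * d t1 \<ge> 0\<close> \<open>\<sigma> * d t2 \<ge> 0\<close> \<open>\<sigma> * d t3 \<ge> 0\<close> sg s1[of j] s2[of j] s3[of j] that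
      by (metis not_le)
    have "\<sigma> * d i \<ge> 0" for i
    proof (rule periodic_window[of d n t1 i])
      fix j assume "t1 \<le> j" "j < t1 + int n" "d j = d i"
      then show ?thesis using win[of j] by simp
    qed (use n4 d_shift in auto)
    then show False using one_sign[OF that(1)] nz by blast
  qed
  have A1: False if \<sigma>: "\<bar>\<sigma>\<bar> = 1" "\<sigma> * d t1 \<le> 0" "\<sigma> * d t2 \<ge> 0" "\<sigma> * d t3 \<ge> 0" for \<sigma>
  proof -
    have "d i = 0" for i
    proof (rule two_arcs[OF \<sigma>(1), of t1 t2])
      show "\<sigma> * d j \<le> 0" if "t1 \<le> j" "j < t2" for j
        using sg' s1 that \<sigma> by blast
      show "\<sigma> * d j \<ge> 0" if "t2 \<le> j" "j < t1 + int n" for j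
        using sg[of j t2 \<sigma>] sg[of j t3 \<sigma>] s2[of j] s3[of j] that \<sigma> by (cases "j < t3") auto
    qed (use t t1 t3 in auto)
    then show False using nz by blast
  qed
  have A2: False if \<sigma>: "\<bar>\<sigma>\<bar> = 1" "\<sigma> * d t1 \<ge> 0" "\<sigma> * d t2 \<le> 0" "\<sigma> * d t3 \<ge> 0" for \<sigma>
  proof -
    have "d i = 0" for i
    proof (rule two_arcs[OF \<sigma>(1), of t2 t3])
      show "\<sigma> * d j \<le> 0" if "t2 \<le> j" "j < t3" for j
        using sg' s2 that \<sigma> by blast
      show "\<sigma> * d j \<ge> 0" if "t3 \<le> j" "j < t2 + int n" for j
        using sg[of j t3 \<sigma>] sg[of j t1 \<sigma>] s3[of j] s1'[of j] that \<sigma>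
        by (cases "j < t1 + int n") auto
    qed (use t t1 t3 in auto)
    then show False using nz by blast
  qed
  have A3: False if \<sigma>: "\<bar>\<sigma>\<bar> = 1" "\<sigma> * d t1 \<ge> 0" "\<sigma> * d t2 \<ge> 0" "\<sigma> * d t3 \<le> 0" for \<sigma>
  proof -
    have "d i = 0" for i
    proof (rule two_arcs[OF \<sigma>(1), of t3 "t1 + int n"])
      show "\<sigma> * d j \<le> 0" if "t3 \<le> j" "j < t1 + int n" for j
        using sg' s3 that \<sigma> by blast
      show "\<sigma> * d j \<ge> 0" if "t1 + int n \<le> j" "j < t3 + int n" for j
        using sg[of j t1 \<sigma>] sg[of j t2 \<sigma>] s1'[of j] s2'[of j] that \<sigma>
        by (cases "j < t2 + int n") auto
    qed (use t t1 t3 in auto)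
    then show False using nz by blast
  qed
  \<comment> \<open>\<sigma> = 1 and \<sigma> = -1 together cover all weak sign patterns of
    \<open>d\<close> at \<open>t1\<close>, \<open>t2\<close>, \<open>t3\<close>.\<close>
  show False
    using A0[of 1] A1[of 1] A2[of 1] A3[of 1] A0[of "-1"] A1[of "-1"] A2[of "-1"] A3[of "-1"]
    by (simp add: not_le) linarith
qed

end

section \<open>Brackets of homogeneous coordinates\<close>

definition cross :: "rp1 \<Rightarrow> rp1 \<Rightarrow> real" where
  "cross p q = hom_coord p $ 1 * hom_coord q $ 2 - hom_coord q $ 1 * hom_coord p $ 2"

text \<open>Take the first coordinate plus \<open>t\<close> times the second as denominator: each
  point excludes at most one value of \<open>t\<close>.\<close>

lemma ex_parameter_finite_at:
  assumes "finite S"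
  shows "\<exists>A. affine_parameter A \<and> (\<forall>p\<in>S. finite_at A p)"
proof -
  have "finite {t. hom_coord p $ 1 + t * hom_coord p $ 2 = 0}" for p
  proof (rule finite_subset)
    have "hom_coord p $ 1 \<noteq> 0" if "hom_coord p $ 2 = 0"
      using hom_coord(2)[of p] that by (simp add: vec_eq_iff forall_2)
    then show "{t. hom_coord p $ 1 + t * hom_coord p $ 2 = 0} \<subseteq> {- hom_coord p $ 1 / hom_coord p $ 2}"
      by (cases "hom_coord p $ 2 = 0") (auto simp: field_simps eq_neg_iff_add_eq_0)
  qed simp
  then have "finite (\<Union>p\<in>S. {t. hom_coord p $ 1 + t * hom_coord p $ 2 = 0})"
    using assms by blast
  then obtain t where "t \<notin> (\<Union>p\<in>S. {t. hom_coord p $ 1 + t * hom_coord p $ 2 = 0})"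
    using ex_new_if_finite[OF infinite_UNIV_char_0] by blast
  then have t: "hom_coord p $ 1 + t * hom_coord p $ 2 \<noteq> 0" if "p \<in> S" for p
    using that by blast
  let ?A = "vector [vector [0, 1], vector [1, t]] :: real^2^2"
  have "det ?A \<noteq> 0" by (simp add: det_2)
  then have "affine_parameter ?A" by (simp add: affine_parameter_def invertible_det_nz)
  moreover have "finite_at ?A p" if "p \<in> S" for p
    using t[OF that] by (simp add: finite_at_def matrix_vector_mult_def sum_2)
  ultimately show ?thesis by blast
qed

text \<open>Differences of parameters are brackets up to the factor \<open>- det A\<close> and the
  denominators \<open>w\<close>; these cancel because each point occurs once in the numerator and
  once in the denominator.\<close>

lemma cross_ratio_cross:
  "cross_ratio a b c d = (cross a c * cross b d) / (cross a b * cross c d)"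
proof -
  obtain A where A: "affine_parameter A"
    and f: "finite_at A a" "finite_at A b" "finite_at A c" "finite_at A d"
    using ex_parameter_finite_at[of "{a, b, c, d}"] by auto
  define w where "w p = (A *v hom_coord p) $ 2" for p
  have w: "w a \<noteq> 0" "w b \<noteq> 0" "w c \<noteq> 0" "w d \<noteq> 0"
    using f by (simp_all add: finite_at_def w_def)
  have diff: "param A q - param A p = - det A * cross p q / (w p * w q)"
    if "finite_at A p" "finite_at A q" for p q
    using param_diff[OF that(2,1)] by (simp add: cross_def w_def algebra_simps)
  define k where "k = det A * det A / (w a * w b * w c * w d)"
  have "k \<noteq> 0"
    using A w by (simp add: k_def affine_parameter_def invertible_det_nz)
  have "(param A c - param A a) * (param A d - param A b) = k * (cross a c * cross b d)"
    "(param A b - param A a) * (param A d - param A c) = k * (cross a b * cross c d)"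
    using f by (simp_all add: diff k_def ac_simps)
  then show ?thesis
    unfolding cross_ratio_eq[OF A f] using \<open>k \<noteq> 0\<close> by simp
qed

text \<open>Each point occurs twice in the triple product, so its sign does not depend on the
  homogeneous coordinates. Increasing parameters give it the sign opposite to \<open>det A\<close>,
  which is fixed by the orientation.\<close>

lemma cyclically_ordered_cross:
  assumes "Or \<in> orientations"
  obtains \<epsilon> :: real where "\<bar>\<epsilon>\<bar> = 1"
    "\<And>p q r. cyclically_ordered Or p q r \<Longrightarrow> \<epsilon> * (cross p q * cross q r * cross p r) > 0"
proof -
  have sign: "det A * (cross p q * cross q r * cross p r) < 0"
    if f: "finite_at A p" "finite_at A q" "finite_at A r"
      and l: "param A p < param A q" "param A q < param A r" for A p q r
  proof -
    define w where "w p = (A *v hom_coord p) $ 2" for p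
    have lt: "det A * cross p q * (w p * w q) < 0"
      if "finite_at A p" "finite_at A q" "param A p < param A q" for p q
    proof -
      have "det A * cross p q / (w p * w q) < 0"
        using param_diff[OF that(1,2)] that(3) by (simp add: cross_def w_def)
      then show ?thesis by (auto simp: divide_less_0_iff mult_less_0_iff)
    qed
    have "(det A * cross p q * (w p * w q)) * (det A * cross q r * (w q * w r)) > 0"
      using lt f l by (intro mult_neg_neg) auto
    then have "(det A * cross p q * (w p * w q)) * (det A * cross q r * (w q * w r))
        * (det A * cross p r * (w p * w r)) < 0"
    proof (rule mult_pos_neg)
      show "det A * cross p r * (w p * w r) < 0" using lt[of p r] f l by simp
    qed
    \<comment> \<open>The denominators and two of the three determinants collect into a square,
      leaving one factor \<open>det A\<close>.\<close>
    also have "(det A * cross p q * (w p * w q)) * (det A * cross q r * (w q * w r))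
        * (det A * cross p r * (w p * w r))
        = (det A * (cross p q * cross q r * cross p r)) * (det A * w p * w q * w r)\<^sup>2"
      by (simp add: power2_eq_square algebra_simps)
    finally show ?thesis
      by (metis mult_less_0_iff not_less zero_le_power2)
  qed
  show ?thesis
  proof (cases "Or = {A. det A > 0}")
    case True
    show ?thesis
    proof (rule that[of "-1"])
      fix p q r assume "cyclically_ordered Or p q r"
      then obtain A where "A \<in> Or" "det A * (cross p q * cross q r * cross p r) < 0"
        using sign unfolding cyclically_ordered_def by meson
      moreover from this have "det A > 0" using True by simp
      ultimately show "-1 * (cross p q * cross q r * cross p r) > 0"
        by (simp add: mult_less_0_iff)
    qed simp
  next
    case False
    then have Or: "Or = {A. det A < 0}" using assms by (auto simp: orientations_def)
    show ?thesis
    proof (rule that[of 1])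
      fix p q r assume "cyclically_ordered Or p q r"
      then obtain A where "A \<in> Or" "det A * (cross p q * cross q r * cross p r) < 0"
        using sign unfolding cyclically_ordered_def by meson
      moreover from this have "det A < 0" using Or by simp
      ultimately show "1 * (cross p q * cross q r * cross p r) > 0"
        using mult_less_0_iff[of "det A"] by auto
    qed simp
  qed
qed

text \<open>Homogeneous coordinates carry arbitrary signs. They are corrected relative to the first
  point on one period and then extended antiperiodically.\<close>

lemma cyclic_bracket_exists:
  assumes n: "n \<ge> 4" and Or: "Or \<in> orientations" and per: "cyclic_tuple n x"
    and ord: "in_cyclic_order Or n x"
  obtains V where "cyclic_bracket n V"
    "\<And>j. cross_ratio (x j) (x (j + 1)) (x (j + 2)) (x (j + 3)) = cyclic_bracket.ratio V j"
proof -
  obtain \<epsilon> :: real where \<epsilon>: "\<bar>\<epsilon>\<bar> = 1"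
    and co: "\<And>p q r. cyclically_ordered Or p q r \<Longrightarrow> \<epsilon> * (cross p q * cross q r * cross p r) > 0"
    using cyclically_ordered_cross[OF Or] by blast
  have \<epsilon>2: "\<epsilon> * \<epsilon> = 1" using \<epsilon> by (metis abs_mult_self_eq mult_1)
  define E where "E i j = \<epsilon> * cross (x i) (x j)" for i j
  have E3: "E i j * E j k * E i k > 0" if "1 \<le> i" "i < j" "j < k" "k \<le> int n" for i j k
  proof -
    have "E i j * E j k * E i k
        = (\<epsilon> * \<epsilon>) * (\<epsilon> * (cross (x i) (x j) * cross (x j) (x k) * cross (x i) (x k)))"
      by (simp add: E_def algebra_simps)
    then show ?thesis
      using co ord that unfolding \<epsilon>2 in_cyclic_order_def by simp
  qed
  \<comment> \<open>The sign \<open>s k\<close> makes the bracket of the first and the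
    \<open>k\<close>-th point positive; positivity of the triple products then carries this over to
    all pairs.\<close>
  define s where "s k = (if k = 1 then 1 else sgn (E 1 k))" for k
  \<comment> \<open>For \<open>k\<close> below \<open>n\<close> use the triple 1, \<open>k\<close>,
    \<open>n\<close>; for \<open>k = n\<close> use 1, 2, \<open>n\<close>.\<close>
  have nz: "E 1 k \<noteq> 0" if "1 < k" "k \<le> int n" for k
    using E3[of 1 k "int n"] E3[of 1 2 k] that n by (cases "k < int n") auto
  have s_nz: "s k \<noteq> 0" if "1 \<le> k" "k \<le> int n" for k
    using nz[of k] that by (auto simp: s_def sgn_0_0)
  have s_pos: "s i * s j * E i j > 0" if "1 \<le> i" "i < j" "j \<le> int n" for i j
  proof (cases "i = 1")
    case True
    then show ?thesis using nz[of j] that by (simp add: s_def sgn_mult_self_eq sgn_if)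
  next
    case False
    then have "E 1 i * E i j * E 1 j > 0" using that by (intro E3) auto
    then have "sgn (E 1 i * E i j * E 1 j) = 1" by simp
    then have "sgn (s i * s j * E i j) = 1"
      using False that by (simp add: s_def sgn_mult mult.commute mult.left_commute)
    then show ?thesis by (simp add: sgn_1_pos)
  qed
  \<comment> \<open>Residues are taken in 1, ..., \<open>n\<close>, the range on which the order is
    given; the parity of the period number in \<open>t\<close> provides the antiperiodicity.\<close>
  define res where "res i = (i - 1) mod int n + 1" for i
  define t where "t i = (if even ((i - 1) div int n) then 1 else - 1) * s (res i)" for i
  have res: "1 \<le> res i" "res i \<le> int n" for i
    using n pos_mod_bound[of "int n" "i - 1"] pos_mod_sign[of "int n" "i - 1"]
    unfolding res_def by linarith+
  have x_res: "x (res i) = x i" for i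
  proof -
    have "res i + int n * ((i - 1) div int n) = i"
      unfolding res_def using div_mult_mod_eq[of "i - 1" "int n"] by (simp add: algebra_simps)
    then show ?thesis
      using periodic_shift[of x "int n" "res i"] per unfolding cyclic_tuple_def by metis
  qed
  have E_res: "E (res i) (res j) = E i j" for i j
    by (simp add: E_def x_res)
  define V where "V i j = t i * t j * E i j" for i j
  have t_nz: "t i \<noteq> 0" for i
    using s_nz[OF res] by (simp add: t_def)
  have t_shift: "t (i + int n) = - t i" for i
  proof -
    have e: "i + int n - 1 = i - 1 + int n" by simp
    show ?thesis unfolding t_def res_def e using n by simp
  qed
  have "cyclic_bracket n V"
  proof
    fix i j k l
    show "V j i = - V i j" by (simp add: V_def E_def cross_def algebra_simps)
    have "V i j * V k l - V i k * V j l + V i l * V j k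
        = t i * t j * t k * t l * (E i j * E k l - E i k * E j l + E i l * E j k)"
      by (simp add: V_def algebra_simps)
    also have "E i j * E k l - E i k * E j l + E i l * E j k = 0"
      by (simp add: E_def cross_def algebra_simps)
    finally show "V i j * V k l - V i k * V j l + V i l * V j k = 0" by simp
    show "V (i + int n) j = - V i j"
      using per by (simp add: V_def t_shift E_def cyclic_tuple_def)
    assume ij: "i < j" "j < i + int n"
    define q q' where "q = (i - 1) div int n" and "q' = (j - 1) div int n"
    have i: "i = res i + q * int n" and j: "j = res j + q' * int n"
      unfolding res_def q_def q'_def
      using div_mult_mod_eq[of "i - 1" "int n"] div_mult_mod_eq[of "j - 1" "int n"] by linarith+
    have "q \<le> q'" unfolding q_def q'_def using ij n by (intro zdiv_mono1) auto
    moreover have "q' \<le> (i - 1 + int n) div int n"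
      unfolding q'_def using ij n by (intro zdiv_mono1) auto
    then have "q' \<le> q + 1" using n by (simp add: q_def)
    \<comment> \<open>Both indices lie in the same period or in adjacent ones. In the second case
      the sign flip of \<open>t\<close> compensates the reversed order of the residues.\<close>
    ultimately consider "q' = q" | "q' = q + 1" by linarith
    then show "V i j > 0"
    proof cases
      case 1
      then have "res i < res j" using i j ij by simp
      then have "s (res i) * s (res j) * E i j > 0"
        using s_pos[of "res i" "res j"] res E_res by simp
      then show ?thesis using 1 by (simp add: V_def t_def q_def[symmetric] q'_def[symmetric])
    next
      case 2
      then have "res j < res i" using i j ij by (simp add: algebra_simps)
      then have "s (res j) * s (res i) * E j i > 0"
        using s_pos[of "res j" "res i"] res E_res by simp
      moreover have "E j i = - E i j" by (simp add: E_def cross_def algebra_simps)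
      ultimately show ?thesis
        using 2 by (simp add: V_def t_def q_def[symmetric] q'_def[symmetric] mult.commute)
    qed
  qed
  moreover have "cross_ratio (x j) (x (j + 1)) (x (j + 2)) (x (j + 3)) = cyclic_bracket.ratio V j"
    for j
  proof -
    let ?t = "t j * t (j + 1) * t (j + 2) * t (j + 3) * (\<epsilon> * \<epsilon>)"
    have "cyclic_bracket.ratio V j
       = (?t * (cross (x j) (x (j + 2)) * cross (x (j + 1)) (x (j + 3))))
         / (?t * (cross (x j) (x (j + 1)) * cross (x (j + 2)) (x (j + 3))))"
      unfolding cyclic_bracket.ratio_def[OF \<open>cyclic_bracket n V\<close>] V_def E_def
      by (intro arg_cong2[where f = "(/)"]) (simp_all add: ac_simps)
    moreover have "?t \<noteq> 0" using t_nz \<epsilon>2 by simp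
    ultimately show ?thesis by (simp add: cross_ratio_cross)
  qed
  ultimately show ?thesis by (rule that)
qed

section \<open>Extremal triples of two cyclically ordered tuples\<close>

theorem theorem2p10:
  fixes n :: nat and Or :: "(real^2^2) set" and x y :: "int \<Rightarrow> rp1"
  assumes "n \<ge> 4"
    and "Or \<in> orientations"
    and "cyclic_tuple n x" and "cyclic_tuple n y"
    and "inj_on x {1..int n}" and "inj_on y {1..int n}"
    and "in_cyclic_order Or n x" and "in_cyclic_order Or n y"
  shows "card {i \<in> {1..int n}. extremal x y i} \<ge> 4"
proof -
  obtain V where V: "cyclic_bracket n V"
    "\<And>j. cross_ratio (x j) (x (j + 1)) (x (j + 2)) (x (j + 3)) = cyclic_bracket.ratio V j"
    using cyclic_bracket_exists assms by blast
  obtain W where W: "cyclic_bracket n W"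
    "\<And>j. cross_ratio (y j) (y (j + 1)) (y (j + 2)) (y (j + 3)) = cyclic_bracket.ratio W j"
    using cyclic_bracket_exists assms by blast
  interpret cyclic_bracket_pair n V W
    using V(1) W(1) assms(1) by (simp add: cyclic_bracket_pair_def cyclic_bracket_pair_axioms_def)
  have "cr_diff x y j = d j" for j
    by (simp only: cr_diff_def d_def V(2) W(2))
  then show ?thesis
    using four_sign_changes by (simp add: extremal_def)
qed

end
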